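(* Let $\mathcal{A},\mathcal{B}$ be $C^*$-algebras with $\mathcal{B}\subseteq\mathscr{B}(\mathcal{H})$ for some Hilbert space $\mathcal{H}$. Fix a projection $R\in\mathcal{B}$. Let $\beta:\mathcal{A}\to\mathcal{B}R$ be a linear map. If $\beta$ is CP completable, then the following properties hold: (i) The map $X\mapsto R\beta(X)$ is completely positive. (ii) There exists $q\geq 0$ such that $$\beta(X)^*(1-R)\beta(X)\leq q\|X\|\,R\beta(X)\quad\text{for all }X\in\mathcal{A}_+.$$ (iii) For every $n\ge 1$ and every $X=[X_{ij}]_{1\leq i,j\leq n}$ in $M_n(\mathcal{A})_+$, the matrix $[\beta(X_{ij})]_{1\leq i,j\leq n}$ in $M_n(\mathcal{B}R)$ is positive completable to an operator in $M_n(\mathcal{B})$.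
   Context: CP means completely positive, and $\mathcal{B}R:=\{YR:Y\in\mathcal{B}\}$. $\mathcal{A}_+$ and $M_n(\mathcal{A})_+$ denote the sets of positive elements of $\mathcal{A}$ and $M_n(\mathcal{A})$, and $1$ is the identity operator on $\mathcal{H}$. A linear map $\beta:\mathcal{A}\to\mathcal{B}R$ is CP completable (with respect to $R$) if there exists a CP map $\varphi:\mathcal{A}\to\mathcal{B}$ such that $\beta(X)=\varphi(X)R$ for all $X\in\mathcal{A}$. A matrix $[b_{ij}]\in M_n(\mathcal{B}R)$ is positive completable to an operator in $M_n(\mathcal{B})$ if there is a positive $[Y_{ij}]\in M_n(\mathcal{B})$ with $Y_{ij}R=b_{ij}$ for all $i,j$. *)

theory Defs
  imports
    "HOL-Analysis.Bounded_Linear_Function"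
    "Jordan_Normal_Form.Matrix"
begin

section \<open>C*-algebras\<close>

class complex_normed_vector = real_normed_vector +
  fixes scaleC :: "complex \<Rightarrow> 'a \<Rightarrow> 'a" (infixr \<open>*\<^sub>C\<close> 75)
  assumes scaleC_add_right: "c *\<^sub>C (x + y) = c *\<^sub>C x + c *\<^sub>C y"
    and scaleC_add_left: "(c + d) *\<^sub>C x = c *\<^sub>C x + d *\<^sub>C x"
    and scaleC_scaleC: "c *\<^sub>C (d *\<^sub>C x) = (c * d) *\<^sub>C x"
    and scaleR_scaleC: "r *\<^sub>R x = complex_of_real r *\<^sub>C x"
    and norm_scaleC: "norm (c *\<^sub>C x) = cmod c * norm x"

text \<open>No unit is assumed.\<close>

class cstar_algebra = complex_normed_vector + real_normed_algebra + banach +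
  fixes star :: "'a \<Rightarrow> 'a"
  assumes mult_scaleC_left: "(c *\<^sub>C x) * y = c *\<^sub>C (x * y)"
    and mult_scaleC_right: "x * (c *\<^sub>C y) = c *\<^sub>C (x * y)"
    and star_add: "star (x + y) = star x + star y"
    and star_scaleC: "star (c *\<^sub>C x) = cnj c *\<^sub>C star x"
    and star_mult: "star (x * y) = star y * star x"
    and star_star: "star (star x) = x"
    and norm_star_mult_self: "norm (star x * x) = (norm x)\<^sup>2"

abbreviation clinear :: "('a::complex_normed_vector \<Rightarrow> 'b::complex_normed_vector) \<Rightarrow> bool" where
  "clinear \<equiv> Vector_Spaces.linear scaleC scaleC"

lemma vector_space_scaleC:
  "vector_space (scaleC :: complex \<Rightarrow> 'a::complex_normed_vector \<Rightarrow> 'a)"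
proof
  show "1 *\<^sub>C x = x" for x :: 'a using scaleR_scaleC[of 1 x] by simp
qed (simp_all add: scaleC_add_right scaleC_add_left scaleC_scaleC)

lemma clinear_iff:
  "clinear f \<longleftrightarrow> (\<forall>x y. f (x + y) = f x + f y) \<and> (\<forall>c x. f (c *\<^sub>C x) = c *\<^sub>C f x)"
  by (auto simp: Vector_Spaces.linear_def module_hom_def module_hom_axioms_def
      module_iff_vector_space vector_space_scaleC)

text \<open>C*-subalgebras of the C*-algebra \<open>'a\<close>: norm-closed, not necessarily unital.\<close>

definition cstar_subalgebra :: "'a::cstar_algebra set \<Rightarrow> bool" where
  "cstar_subalgebra S \<longleftrightarrow>
     0 \<in> S \<and> (\<forall>x\<in>S. \<forall>y\<in>S. x + y \<in> S) \<and> (\<forall>c. \<forall>x\<in>S. c *\<^sub>C x \<in> S) \<and>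
     (\<forall>x\<in>S. \<forall>y\<in>S. x * y \<in> S) \<and> (\<forall>x\<in>S. star x \<in> S) \<and> closed S"

definition is_projection :: "'a::cstar_algebra \<Rightarrow> bool" where
  "is_projection p \<longleftrightarrow> star p = p \<and> p * p = p"

text \<open>The positive elements of a C*-algebra \<open>S\<close> are those of the form \<open>y* y\<close> with \<open>y \<in> S\<close>.
  The same definition is used in \<open>M\<^sub>n(S)\<close>, whose elements are the \<open>n \<times> n\<close> matrices with
  entries in \<open>S\<close>; its C*-norm plays no role in it.\<close>

definition pos_elems :: "'a::cstar_algebra set \<Rightarrow> 'a set" where
  "pos_elems S = {star y * y |y. y \<in> S}"

text \<open>The order of the ambient C*-algebra; for operators on \<open>H\<close> that is \<open>B(H)\<close>.\<close>

definition cstar_le :: "'a::cstar_algebra \<Rightarrow> 'a \<Rightarrow> bool" (infix \<open>\<preceq>\<close> 50) where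
  "x \<preceq> y \<longleftrightarrow> y - x \<in> pos_elems UNIV"

text \<open>\<open>M\<^sub>n(S)\<close>; also used for \<open>S = BR\<close>, which need not be an algebra.\<close>

definition mat_alg :: "nat \<Rightarrow> 'a set \<Rightarrow> 'a mat set" where
  "mat_alg n S = {X \<in> carrier_mat n n. elements_mat X \<subseteq> S}"

definition mat_star :: "'a::cstar_algebra mat \<Rightarrow> 'a mat" where
  "mat_star X = map_mat star (transpose_mat X)"

definition pos_mats :: "nat \<Rightarrow> 'a::cstar_algebra set \<Rightarrow> 'a mat set" where
  "pos_mats n S = {mat_star Y * Y |Y. Y \<in> mat_alg n S}"

definition completely_positive ::
  "'b set \<Rightarrow> ('a::cstar_algebra \<Rightarrow> 'b::cstar_algebra) \<Rightarrow> bool" where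
  "completely_positive T \<phi> \<longleftrightarrow> clinear \<phi> \<and> range \<phi> \<subseteq> T \<and>
     (\<forall>n\<ge>1. \<forall>X \<in> pos_mats n UNIV. map_mat \<phi> X \<in> pos_mats n T)"

definition mult_right :: "'b::cstar_algebra set \<Rightarrow> 'b \<Rightarrow> 'b set" where
  "mult_right B R = {Y * R |Y. Y \<in> B}"

definition cp_completable ::
  "'b set \<Rightarrow> 'b \<Rightarrow> ('a::cstar_algebra \<Rightarrow> 'b::cstar_algebra) \<Rightarrow> bool" where
  "cp_completable B R \<beta> \<longleftrightarrow> (\<exists>\<phi>. completely_positive B \<phi> \<and> (\<forall>X. \<beta> X = \<phi> X * R))"

definition positive_completable ::
  "nat \<Rightarrow> 'b::cstar_algebra set \<Rightarrow> 'b \<Rightarrow> 'b mat \<Rightarrow> bool" where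
  "positive_completable n B R b \<longleftrightarrow>
     b \<in> mat_alg n (mult_right B R) \<and> (\<exists>Y \<in> pos_mats n B. map_mat (\<lambda>y. y * R) Y = b)"

section \<open>The C*-algebra of bounded operators on a complex Hilbert space\<close>

text \<open>The real inner product of the library class is required to be the real part of the complex
  one, so the norm is \<open>sqrt (Re (cinner x x))\<close> as usual. The complex inner product is linear in
  its first argument.\<close>

class chilbert_space = complex_normed_vector + real_inner + complete_space +
  fixes cinner :: "'a \<Rightarrow> 'a \<Rightarrow> complex"
  assumes cinner_commute: "cinner x y = cnj (cinner y x)"
    and cinner_add_left: "cinner (x + y) z = cinner x z + cinner y z"
    and cinner_scaleC_left: "cinner (c *\<^sub>C x) y = c * cinner x y"
    and inner_eq_Re_cinner: "inner x y = Re (cinner x y)"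

subclass (in chilbert_space) banach ..

lemma riesz_representation:
  fixes f :: "'h::{real_inner,complete_space} \<Rightarrow> real"
  assumes "bounded_linear f"
  shows "\<exists>z. \<forall>x. f x = inner x z"
proof -
  interpret f: bounded_linear f by fact
  define J where "J x = (norm x)\<^sup>2 - 2 * f x" for x
  obtain K where K: "\<And>x. norm (f x) \<le> norm x * K" using f.bounded by blast
  have lb: "- (K\<^sup>2) \<le> J x" for x
  proof -
    have "f x \<le> norm x * K" using K[of x] by simp
    moreover have "0 \<le> (norm x - K)\<^sup>2" by simp
    ultimately show ?thesis unfolding J_def power2_diff mult.assoc by linarith
  qed
  define m where "m = Inf (range J)"
  have bdd: "bdd_below (range J)" using lb by (auto intro!: bdd_belowI)
  have m: "m \<le> J x" for x unfolding m_def by (rule cInf_lower) (use bdd in auto)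
  have "\<exists>x. J x < m + 1 / real (Suc n)" for n
    using cInf_lessD[of "range J" "m + 1 / real (Suc n)"] by (auto simp: m_def)
  then obtain u where u: "\<And>n. J (u n) < m + 1 / real (Suc n)" by metis
  have par: "(norm (x - y))\<^sup>2 = 2 * J x + 2 * J y - 4 * J ((1/2) *\<^sub>R (x + y))" for x y
  proof -
    have "(norm (x - y))\<^sup>2 = (norm x)\<^sup>2 + (norm y)\<^sup>2 - 2 * inner x y"
      unfolding power2_norm_eq_inner by (simp add: inner_simps inner_commute)
    moreover have "(norm ((1/2) *\<^sub>R (x + y)))\<^sup>2
        = ((norm x)\<^sup>2 + (norm y)\<^sup>2 + 2 * inner x y) / 4"
      unfolding power2_norm_eq_inner by (simp add: inner_simps inner_commute)
    moreover have "f ((1/2) *\<^sub>R (x + y)) = (f x + f y) / 2" by (simp add: f.add f.scaleR)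
    ultimately show ?thesis unfolding J_def by argo
  qed
  have "Cauchy u"
  proof (rule CauchyI)
    fix e :: real assume e: "0 < e"
    then obtain N where N: "4 / e\<^sup>2 < real N" using reals_Archimedean2 by blast
    then have N': "4 < e\<^sup>2 * real N" using e by (simp add: field_simps)
    then have N0: "0 < N" by (cases N) auto
    have "norm (u i - u j) < e" if "N \<le> i" "N \<le> j" for i j
    proof -
      have "(norm (u i - u j))\<^sup>2 \<le> 2 * J (u i) + 2 * J (u j) - 4 * m"
        using par[of "u i" "u j"] m[of "(1/2) *\<^sub>R (u i + u j)"] by linarith
      also have "\<dots> \<le> 2 / real (Suc i) + 2 / real (Suc j)"
        using u[of i] u[of j] by linarith
      also have "\<dots> \<le> 2 / real N + 2 / real N"
        using that N0 by (intro add_mono divide_left_mono) auto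
      also have "\<dots> < e\<^sup>2" using N' N0 by (simp add: field_simps)
      finally show ?thesis using e by (simp add: power2_less_imp_less)
    qed
    then show "\<exists>N. \<forall>i\<ge>N. \<forall>j\<ge>N. norm (u i - u j) < e" by blast
  qed
  then obtain z where z: "u \<longlonglongrightarrow> z" using Cauchy_convergent_iff convergent_def by blast
  have "(\<lambda>n. J (u n)) \<longlonglongrightarrow> J z"
    unfolding J_def by (intro tendsto_intros z f.tendsto)
  moreover have "(\<lambda>n. m + 1 / real (Suc n)) \<longlonglongrightarrow> m + 0"
    by (intro tendsto_intros lim_1_over_n[THEN LIMSEQ_Suc])
  ultimately have "J z \<le> m + 0"
    using u by (intro LIMSEQ_le) (auto intro: less_imp_le)
  then have min: "J z \<le> J x" for x using m[of x] by simp
  have "f x = inner x z" for x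
  proof (rule ccontr)
    assume ne: "f x \<noteq> inner x z"
    define a where "a = f x - inner x z"
    have exp: "J (z + t *\<^sub>R x) = J z - 2 * t * a + t\<^sup>2 * (norm x)\<^sup>2" for t
      unfolding J_def a_def power2_norm_eq_inner
      by (simp add: f.add f.scaleR inner_simps inner_commute power2_eq_square algebra_simps)
    have ge: "2 * t * a \<le> t\<^sup>2 * (norm x)\<^sup>2" for t
      using min[of "z + t *\<^sub>R x"] exp[of t] by simp
    have "x \<noteq> 0" using ne f.zero by auto
    define N where "N = (norm x)\<^sup>2"
    then have px: "0 < N" using \<open>x \<noteq> 0\<close> by simp
    have "2 * (a / N) * a \<le> (a / N)\<^sup>2 * N" unfolding N_def by (rule ge)
    then have "a * a \<le> 0" using px by (simp add: power2_eq_square field_simps)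
    then show False using ne by (auto simp: a_def mult_le_0_iff)
  qed
  then show ?thesis by blast
qed

lemma scaleC_zero_right [simp]: "c *\<^sub>C (0::'a::complex_normed_vector) = 0"
  using scaleC_add_right[of c "0::'a" 0] by simp

lemma scaleC_minus_right: "c *\<^sub>C (- x) = - (c *\<^sub>C (x::'a::complex_normed_vector))"
  using scaleC_add_right[of c x "- x"] by (simp add: eq_neg_iff_add_eq_0 add.commute)

lemma scaleC_diff_right: "c *\<^sub>C (x - y) = c *\<^sub>C x - c *\<^sub>C (y::'a::complex_normed_vector)"
  using scaleC_add_right[of c x "- y"] by (simp add: scaleC_minus_right)

lemma scaleC_scaleR_commute: "c *\<^sub>C (r *\<^sub>R x) = r *\<^sub>R (c *\<^sub>C (x::'a::complex_normed_vector))"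
  by (simp add: scaleR_scaleC scaleC_scaleC mult.commute)

lemma bounded_linear_scaleC: "bounded_linear (\<lambda>x::'a::complex_normed_vector. c *\<^sub>C x)"
  by (rule bounded_linear_intro[where K = "cmod c"])
    (simp_all add: scaleC_add_right scaleC_scaleR_commute norm_scaleC mult.commute)

lemma cinner_add_right: "cinner x (y + z) = cinner x y + cinner x (z::'h::chilbert_space)"
  by (subst (1 2 3) cinner_commute) (simp add: cinner_add_left)

lemma cinner_scaleC_right: "cinner x (c *\<^sub>C y) = cnj c * cinner x (y::'h::chilbert_space)"
  by (subst (1 2) cinner_commute) (simp add: cinner_scaleC_left)

lemma cinner_eq_inner:
  "cinner x y = Complex (inner x y) (- inner (\<i> *\<^sub>C x) (y::'h::chilbert_space))"
  by (simp add: inner_eq_Re_cinner cinner_scaleC_left complex_eq_iff)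

text \<open>\<open>'h bop\<close> is \<open>B(H)\<close>, with \<open>'h\<close> the Hilbert space \<open>H\<close>: the bounded real-linear operators
  of the library that are complex-linear, with the operator norm.\<close>

typedef (overloaded) 'h bop =
  "{T :: 'h::chilbert_space \<Rightarrow>\<^sub>L 'h. \<forall>c x. T (c *\<^sub>C x) = c *\<^sub>C T x}"
  morphisms blinfun_of_bop Bop
  by (rule exI[of _ 0]) simp

setup_lifting type_definition_bop

abbreviation bop_apply :: "'h::chilbert_space bop \<Rightarrow> 'h \<Rightarrow> 'h" where
  "bop_apply T \<equiv> blinfun_apply (blinfun_of_bop T)"

lemma bop_apply_scaleC: "bop_apply T (c *\<^sub>C x) = c *\<^sub>C bop_apply T x"
  using blinfun_of_bop[of T] by simp

lemma bop_eqI: "(\<And>x. bop_apply S x = bop_apply T x) \<Longrightarrow> S = T"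
  by (simp add: blinfun_of_bop_inject[symmetric] blinfun_eqI)

instantiation bop :: (chilbert_space) complex_normed_vector
begin

lift_definition zero_bop :: "'a bop" is 0 by simp
lift_definition plus_bop :: "'a bop \<Rightarrow> 'a bop \<Rightarrow> 'a bop" is "(+)"
  by (simp add: blinfun.bilinear_simps scaleC_add_right)
lift_definition minus_bop :: "'a bop \<Rightarrow> 'a bop \<Rightarrow> 'a bop" is "(-)"
  by (simp add: blinfun.bilinear_simps scaleC_diff_right)
lift_definition uminus_bop :: "'a bop \<Rightarrow> 'a bop" is uminus
  by (simp add: blinfun.bilinear_simps scaleC_minus_right)
lift_definition scaleR_bop :: "real \<Rightarrow> 'a bop \<Rightarrow> 'a bop" is scaleR
  by (simp add: blinfun.bilinear_simps scaleC_scaleR_commute)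
lift_definition scaleC_bop :: "complex \<Rightarrow> 'a bop \<Rightarrow> 'a bop" is
  "\<lambda>c T. Blinfun (\<lambda>x. c *\<^sub>C blinfun_apply T x)"
  by (simp add: bounded_linear_Blinfun_apply scaleC_scaleC mult.commute
      bounded_linear_compose[OF bounded_linear_scaleC blinfun.bounded_linear_right])
lift_definition norm_bop :: "'a bop \<Rightarrow> real" is norm .

definition dist_bop :: "'a bop \<Rightarrow> 'a bop \<Rightarrow> real" where
  "dist_bop S T = norm (S - T)"
definition sgn_bop :: "'a bop \<Rightarrow> 'a bop" where
  "sgn_bop T = inverse (norm T) *\<^sub>R T"
definition uniformity_bop :: "('a bop \<times> 'a bop) filter" where
  [code del]: "uniformity_bop = (INF e\<in>{0 <..}. principal {(x, y). dist x y < e})"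
definition open_bop :: "'a bop set \<Rightarrow> bool" where
  [code del]: "open_bop S = (\<forall>x\<in>S. \<forall>\<^sub>F (x', y) in uniformity. x' = x \<longrightarrow> y \<in> S)"

lemma bop_apply_scaleC_left: "bop_apply (c *\<^sub>C T) x = c *\<^sub>C bop_apply T x"
  by (simp add: scaleC_bop.rep_eq bounded_linear_Blinfun_apply
      bounded_linear_compose[OF bounded_linear_scaleC blinfun.bounded_linear_right])

lemmas bop_apply_simps =
  zero_bop.rep_eq plus_bop.rep_eq minus_bop.rep_eq uminus_bop.rep_eq scaleR_bop.rep_eq
  blinfun.bilinear_simps bop_apply_scaleC_left

instance
proof
  fix S T U :: "'a bop" and r s :: real and c d :: complex
  show "S + T + U = S + (T + U)" "S + T = T + S" "0 + S = S" "- S + S = 0" "S - T = S + - T"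
    "r *\<^sub>R (S + T) = r *\<^sub>R S + r *\<^sub>R T" "(r + s) *\<^sub>R S = r *\<^sub>R S + s *\<^sub>R S"
    "r *\<^sub>R s *\<^sub>R S = (r * s) *\<^sub>R S" "1 *\<^sub>R S = S"
    by (transfer; simp add: algebra_simps)+
  show "dist S T = norm (S - T)" by (rule dist_bop_def)
  show "sgn S = inverse (norm S) *\<^sub>R S" by (rule sgn_bop_def)
  show "uniformity = (INF e\<in>{0<..}. principal {(x, y :: 'a bop). dist x y < e})"
    by (rule uniformity_bop_def)
  show "open A = (\<forall>x\<in>A. \<forall>\<^sub>F (x', y) in uniformity. x' = x \<longrightarrow> y \<in> A)" for A :: "'a bop set"
    by (rule open_bop_def)
  show "(norm S = 0) = (S = 0)" by transfer simp
  show "norm (S + T) \<le> norm S + norm T" by transfer (rule norm_triangle_ineq)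
  show "norm (r *\<^sub>R S) = \<bar>r\<bar> * norm S" by transfer simp
  show "c *\<^sub>C (S + T) = c *\<^sub>C S + c *\<^sub>C T" "(c + d) *\<^sub>C S = c *\<^sub>C S + d *\<^sub>C S"
    "c *\<^sub>C d *\<^sub>C S = (c * d) *\<^sub>C S" "r *\<^sub>R S = complex_of_real r *\<^sub>C S"
    by (rule bop_eqI; simp add: bop_apply_simps scaleC_add_right scaleC_add_left scaleC_scaleC
        scaleR_scaleC)+
  have le: "norm (c *\<^sub>C S) \<le> cmod c * norm S" for c and S :: "'a bop"
    unfolding norm_bop.rep_eq
  proof (rule norm_blinfun_bound)
    show "norm (bop_apply (c *\<^sub>C S) x) \<le> cmod c * norm (blinfun_of_bop S) * norm x" for x
      using norm_blinfun[of "blinfun_of_bop S" x]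
      by (simp add: bop_apply_simps norm_scaleC mult.assoc mult_left_mono)
  qed simp
  show "norm (c *\<^sub>C S) = cmod c * norm S"
  proof (cases "c = 0")
    case True
    have "norm (c *\<^sub>C S) \<ge> 0" by transfer simp
    then show ?thesis using True le[of c S] by simp
  next
    case False
    have "inverse c *\<^sub>C c *\<^sub>C S = S"
    proof (rule bop_eqI)
      fix x
      have "1 *\<^sub>C bop_apply S x = bop_apply S x"
        using scaleR_scaleC[of 1 "bop_apply S x"] by simp
      then show "bop_apply (inverse c *\<^sub>C c *\<^sub>C S) x = bop_apply S x"
        using False by (simp add: bop_apply_simps scaleC_scaleC)
    qed
    then have "norm S \<le> inverse (cmod c) * norm (c *\<^sub>C S)"
      using le[of "inverse c" "c *\<^sub>C S"] by (simp add: norm_inverse)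
    then have "cmod c * norm S \<le> norm (c *\<^sub>C S)"
      using False by (simp add: field_simps)
    then show ?thesis using le[of c S] by simp
  qed
qed

end

lemma bop_norm_apply: "norm (bop_apply T x) \<le> norm T * norm x"
  by (simp add: norm_bop.rep_eq norm_blinfun)

lemma bop_norm_bound: "0 \<le> b \<Longrightarrow> (\<And>x. norm (bop_apply T x) \<le> b * norm x) \<Longrightarrow> norm T \<le> b"
  by (simp add: norm_bop.rep_eq norm_blinfun_bound)

instance bop :: (chilbert_space) banach
proof
  fix X :: "nat \<Rightarrow> 'a bop" assume X: "Cauchy X"
  have d: "dist S T = dist (blinfun_of_bop S) (blinfun_of_bop T)" for S T :: "'a bop"
    by (simp add: dist_norm norm_bop.rep_eq minus_bop.rep_eq)
  have "Cauchy (\<lambda>n. blinfun_of_bop (X n))" using X by (simp add: Cauchy_def d)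
  then obtain L where L: "(\<lambda>n. blinfun_of_bop (X n)) \<longlonglongrightarrow> L"
    using Cauchy_convergent_iff convergent_def by blast
  have "blinfun_apply L (c *\<^sub>C x) = c *\<^sub>C blinfun_apply L x" for c x
  proof (rule LIMSEQ_unique)
    show "(\<lambda>n. bop_apply (X n) (c *\<^sub>C x)) \<longlonglongrightarrow> blinfun_apply L (c *\<^sub>C x)"
      by (intro blinfun.tendsto L tendsto_const)
    show "(\<lambda>n. bop_apply (X n) (c *\<^sub>C x)) \<longlonglongrightarrow> c *\<^sub>C blinfun_apply L x"
      unfolding bop_apply_scaleC
      by (intro bounded_linear.tendsto[OF bounded_linear_scaleC] blinfun.tendsto L tendsto_const)
  qed
  then have "blinfun_of_bop (Bop L) = L" by (simp add: Bop_inverse)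
  then have "X \<longlonglongrightarrow> Bop L" using L by (simp add: tendsto_iff d)
  then show "convergent X" by (rule convergentI)
qed

instantiation bop :: (chilbert_space) "{one, times}"
begin

lift_definition one_bop :: "'a bop" is id_blinfun by simp
lift_definition times_bop :: "'a bop \<Rightarrow> 'a bop \<Rightarrow> 'a bop" is blinfun_compose by simp

instance ..

end

lemma bop_apply_times [simp]: "bop_apply (S * T) x = bop_apply S (bop_apply T x)"
  by (simp add: times_bop.rep_eq)

lemma bop_apply_one [simp]: "bop_apply 1 x = x"
  by (simp add: one_bop.rep_eq)

definition is_adjoint :: "'h::chilbert_space bop \<Rightarrow> 'h bop \<Rightarrow> bool" where
  "is_adjoint T S \<longleftrightarrow> (\<forall>x y. cinner (bop_apply T x) y = cinner x (bop_apply S y))"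

lemma cinner_right_eqI:
  assumes "\<And>x. cinner x y = cinner x (z::'h::chilbert_space)"
  shows "y = z"
proof -
  have "inner (y - z) (y - z) = 0"
    unfolding inner_diff_right unfolding inner_eq_Re_cinner using assms[of "y - z"] by simp
  then show ?thesis by simp
qed

lemma ex_adjoint: "\<exists>S. is_adjoint T S" for T :: "'h::chilbert_space bop"
proof -
  have "bounded_linear (\<lambda>x. inner (bop_apply T x) y)" for y
    by (intro bounded_linear_inner_left_comp blinfun.bounded_linear_right)
  then have "\<forall>y. \<exists>z. \<forall>x. inner (bop_apply T x) y = inner x z"
    using riesz_representation by blast
  then obtain s where s: "\<And>x y. inner (bop_apply T x) y = inner x (s y)" by metis
  have cs: "cinner (bop_apply T x) y = cinner x (s y)" for x y
    by (simp add: cinner_eq_inner s flip: bop_apply_scaleC)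
  have add: "s (x + y) = s x + s y" for x y
    by (rule cinner_right_eqI) (simp add: cinner_add_right flip: cs)
  have scale: "s (c *\<^sub>C x) = c *\<^sub>C s x" for c x
    by (rule cinner_right_eqI) (simp add: cinner_scaleC_right flip: cs)
  have bl: "bounded_linear s"
  proof (rule bounded_linear_intro[where K = "norm T"])
    fix x :: 'h
    have "norm (s x) * norm (s x) = inner (bop_apply T (s x)) x"
      by (simp add: s flip: power2_norm_eq_inner power2_eq_square)
    also have "\<dots> \<le> norm (bop_apply T (s x)) * norm x" by (rule norm_cauchy_schwarz)
    also have "\<dots> \<le> norm T * norm (s x) * norm x"
      by (intro mult_right_mono bop_norm_apply) simp
    finally have "norm (s x) * norm (s x) \<le> norm (s x) * (norm x * norm T)"
      by (simp add: mult_ac)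
    then show "norm (s x) \<le> norm x * norm T"
      by (cases "s x = 0") simp_all
  qed (simp_all add: add scale scaleR_scaleC)
  have "bop_apply (Bop (Blinfun s)) = s"
    by (simp add: Bop_inverse bounded_linear_Blinfun_apply[OF bl] scale)
  then show ?thesis unfolding is_adjoint_def using cs by metis
qed

lemma is_adjoint_unique: "is_adjoint T S \<Longrightarrow> is_adjoint T S' \<Longrightarrow> S = S'"
  unfolding is_adjoint_def by (intro bop_eqI cinner_right_eqI) metis

lemma is_adjoint_sym: "is_adjoint T S \<Longrightarrow> is_adjoint S T"
  unfolding is_adjoint_def by (metis cinner_commute)

instantiation bop :: (chilbert_space) cstar_algebra
begin

definition star_bop :: "'a bop \<Rightarrow> 'a bop" where
  "star_bop T = (THE S. is_adjoint T S)"

lemma is_adjoint_star: "is_adjoint T (star T)" for T :: "'a bop"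
  unfolding star_bop_def using ex_adjoint is_adjoint_unique by (metis theI)

lemma star_bop_eqI: "is_adjoint T S \<Longrightarrow> star T = S" for T :: "'a bop"
  using is_adjoint_star is_adjoint_unique by blast

lemma cinner_star: "cinner (bop_apply T x) y = cinner x (bop_apply (star T) y)"
  for T :: "'a bop"
  using is_adjoint_star by (simp add: is_adjoint_def)

instance
proof
  fix S T U :: "'a bop" and r :: real and c :: complex
  show "S * T * U = S * (T * U)" "(S + T) * U = S * U + T * U" "S * (T + U) = S * T + S * U"
    "r *\<^sub>R S * T = r *\<^sub>R (S * T)" "S * r *\<^sub>R T = r *\<^sub>R (S * T)"
    "(c *\<^sub>C S) * T = c *\<^sub>C (S * T)" "S * (c *\<^sub>C T) = c *\<^sub>C (S * T)"
    by (rule bop_eqI; simp add: bop_apply_simps bop_apply_scaleC)+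
  have mult_le: "norm (S * T) \<le> norm S * norm T" for S T :: "'a bop"
    by transfer (rule norm_blinfun_compose)
  show "norm (S * T) \<le> norm S * norm T" by (rule mult_le)
  show "star (S + T) = star S + star T"
    by (rule star_bop_eqI)
      (simp add: is_adjoint_def bop_apply_simps cinner_add_left cinner_add_right cinner_star)
  show "star (c *\<^sub>C S) = cnj c *\<^sub>C star S"
    by (rule star_bop_eqI)
      (simp add: is_adjoint_def bop_apply_simps cinner_scaleC_left cinner_scaleC_right cinner_star)
  show "star (S * T) = star T * star S"
    by (rule star_bop_eqI) (simp add: is_adjoint_def cinner_star)
  show star_star: "star (star S) = S" for S :: "'a bop"
    by (rule star_bop_eqI) (rule is_adjoint_sym[OF is_adjoint_star])
  have sq: "(norm S)\<^sup>2 \<le> norm (star S * S)" for S :: "'a bop"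
  proof -
    have "norm S \<le> sqrt (norm (star S * S))"
    proof (rule bop_norm_bound)
      fix x
      have "(norm (bop_apply S x))\<^sup>2 = inner x (bop_apply (star S * S) x)"
        by (simp add: power2_norm_eq_inner inner_eq_Re_cinner cinner_star)
      also have "\<dots> \<le> norm x * norm (bop_apply (star S * S) x)" by (rule norm_cauchy_schwarz)
      also have "\<dots> \<le> norm x * (norm (star S * S) * norm x)"
        by (intro mult_left_mono bop_norm_apply) simp
      also have "\<dots> = (sqrt (norm (star S * S)) * norm x)\<^sup>2"
        by (simp add: power_mult_distrib power2_eq_square mult_ac)
      finally show "norm (bop_apply S x) \<le> sqrt (norm (star S * S)) * norm x"
        by (rule power2_le_imp_le) simp
    qed simp
    then have "(norm S)\<^sup>2 \<le> (sqrt (norm (star S * S)))\<^sup>2" by (intro power_mono) auto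
    then show ?thesis by simp
  qed
  have le: "norm S \<le> norm (star S)" for S :: "'a bop"
  proof (cases "norm S = 0")
    case False
    have "norm S * norm S \<le> norm (star S) * norm S"
      using sq[of S] mult_le[of "star S" S] by (simp add: power2_eq_square)
    then show ?thesis using False by simp
  qed simp
  have "norm (star S) = norm S" using le[of S] le[of "star S"] star_star[of S] by simp
  then show "norm (star S * S) = (norm S)\<^sup>2"
    using sq[of S] mult_le[of "star S" S] by (simp add: power2_eq_square)
qed

end

end

theory Submission
  imports Defs
begin

text \<open>
  Let \<open>\<beta> X = \<phi> X * R\<close> with \<open>\<phi>\<close> completely positive. The complete positivity of \<open>R \<beta>(\<cdot>) = R \<phi>(\<cdot>) R\<close>
  is compression of a positive matrix (lemma \<open>completely_positive_compression\<close>), and the completion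
  of the matrix \<open>[\<beta> X\<^sub>i\<^sub>j]\<close> is \<open>[\<phi> X\<^sub>i\<^sub>j]\<close>.

  For the inequality, \<open>T = \<phi> X\<close> is positive and \<open>\<beta>(X)* (1 - R) \<beta>(X) = R T (1 - R) T R\<close>, which is at most
  \<open>R T\<^sup>2 R \<le> \<parallel>T\<parallel> R T R = \<parallel>T\<parallel> R \<beta>(X)\<close> (lemma \<open>corner_inequality\<close>). It remains to find \<open>q\<close> with
  \<open>\<parallel>\<phi> X\<parallel> \<le> q \<parallel>X\<parallel>\<close> on positive \<open>X\<close>: the automatic continuity of positive maps (lemma
  \<open>positive_map_bounded\<close>). The classical argument sums a series of positive elements on which \<open>\<phi>\<close> grows
  too fast. It needs the tail of such a series to be positive again, in the sense of being of the
  form \<open>z* z\<close>; in a general algebra without unit that usually rests on spectral theory. Spectra are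
  avoided here in two steps.

  \<^item> Only squares \<open>h\<^sup>2\<close> of self-adjoint \<open>h\<close> enter the series, because
    \<open>y* y + y y*\<close> is a sum of two such squares up to the factor \<open>2\<close>.
  \<^item> For self-adjoint \<open>h\<close> in the unit ball, \<open>1 - h\<^sup>2\<close> acts as a contraction by left multiplication.
    The condition that \<open>1 - a\<close> be a contraction survives infinite convex combinations, and it
    implies that \<open>a\<close> is the square of a self-adjoint element, by the binomial series of the square
    root, which converges absolutely on the boundary of its disc.
\<close>

section \<open>The binomial coefficients of the square root\<close>

text \<open>These are the coefficients of \<open>f(t) = 1 - sqrt (1 - t)\<close>, the power series with \<open>f\<^sup>2 = 2 f - t\<close> and
  \<open>f(0) = 0\<close>. Solving this equation coefficientwise gives a recursion that makes all coefficients
  visibly nonnegative.\<close>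

fun sqrt_coeff :: "nat \<Rightarrow> real" where
  "sqrt_coeff n = (if n = 0 then 0 else if n = 1 then 1 / 2
     else (\<Sum>i\<in>{1..<n}. sqrt_coeff i * sqrt_coeff (n - i)) / 2)"

declare sqrt_coeff.simps [simp del]

lemma sqrt_coeff_0 [simp]: "sqrt_coeff 0 = 0"
  by (simp add: sqrt_coeff.simps)

lemma sqrt_coeff_nonneg: "0 \<le> sqrt_coeff n"
proof (induction n rule: less_induct)
  case (less n)
  then show ?case
    by (subst sqrt_coeff.simps) (auto intro!: sum_nonneg mult_nonneg_nonneg)
qed

text \<open>The coefficientwise form of \<open>f\<^sup>2 = 2 f - t\<close>.\<close>

lemma sqrt_coeff_convolution:
  "(\<Sum>i\<le>m. sqrt_coeff i * sqrt_coeff (m - i)) = 2 * sqrt_coeff m - (if m = 1 then 1 else 0)"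
proof -
  have "(\<Sum>i\<le>m. sqrt_coeff i * sqrt_coeff (m - i))
      = (\<Sum>i\<in>{1..<m}. sqrt_coeff i * sqrt_coeff (m - i))"
  proof (rule sum.mono_neutral_right)
    show "\<forall>i\<in>{..m} - {1..<m}. sqrt_coeff i * sqrt_coeff (m - i) = 0"
    proof
      fix i assume "i \<in> {..m} - {1..<m}"
      then have "i = 0 \<or> i = m" by auto
      then show "sqrt_coeff i * sqrt_coeff (m - i) = 0" by auto
    qed
  qed auto
  also have "\<dots> = 2 * sqrt_coeff m - (if m = 1 then 1 else 0)"
    by (subst (3) sqrt_coeff.simps) auto
  finally show ?thesis .
qed

lemma sqrt_coeff_triangle_sum:
  fixes v :: "nat \<Rightarrow> 'a::real_vector"
  assumes "1 \<le> N"
  shows "(\<Sum>(i, j) | i + j \<le> N. (sqrt_coeff i * sqrt_coeff j) *\<^sub>R v (i + j))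
    = 2 *\<^sub>R (\<Sum>m\<le>N. sqrt_coeff m *\<^sub>R v m) - v 1"
proof -
  have "(\<Sum>(i, j) | i + j \<le> N. (sqrt_coeff i * sqrt_coeff j) *\<^sub>R v (i + j))
      = (\<Sum>m\<le>N. \<Sum>i\<le>m. (sqrt_coeff i * sqrt_coeff (m - i)) *\<^sub>R v (i + (m - i)))"
    by (rule sum.triangle_reindex_eq)
  also have "\<dots> = (\<Sum>m\<le>N. (\<Sum>i\<le>m. sqrt_coeff i * sqrt_coeff (m - i)) *\<^sub>R v m)"
    unfolding scaleR_sum_left by (intro sum.cong) auto
  also have "\<dots> = (\<Sum>m\<le>N. 2 *\<^sub>R (sqrt_coeff m *\<^sub>R v m) - (if m = 1 then v m else 0))"
    unfolding sqrt_coeff_convolution by (intro sum.cong) (auto simp: scaleR_left_diff_distrib)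
  also have "\<dots> = 2 *\<^sub>R (\<Sum>m\<le>N. sqrt_coeff m *\<^sub>R v m) - v 1"
    using assms by (simp add: sum_subtractf scaleR_sum_right)
  finally show ?thesis .
qed

lemma finite_triangle: "finite {(i, j :: nat). i + j \<le> N}"
  by (rule finite_subset[of _ "{..N} \<times> {..N}"]) auto

lemma sqrt_coeff_triangle_sum_scalar:
  assumes "1 \<le> N"
  shows "(\<Sum>(i, j) | i + j \<le> N. sqrt_coeff i * sqrt_coeff j) = 2 * (\<Sum>m\<le>N. sqrt_coeff m) - 1"
  using sqrt_coeff_triangle_sum[OF assms, of "\<lambda>_. 1 :: real"] by simp

lemma square_sum_eq:
  "(\<Sum>i\<le>N. sqrt_coeff i)\<^sup>2 = (\<Sum>(i, j)\<in>{..N} \<times> {..N}. sqrt_coeff i * sqrt_coeff j)"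
  by (simp add: power2_eq_square sum_product sum.cartesian_product)

text \<open>Let \<open>S N\<close> be the partial sum. A product of coefficients with \<open>i + j \<le> Suc N\<close> vanishes unless both indices are at
  most \<open>N\<close>, so \<open>2 S (Suc N) - 1 \<le> (S N)\<^sup>2\<close> and the bound passes from \<open>N\<close> to \<open>Suc N\<close>.\<close>

lemma sum_sqrt_coeff_le_1: "(\<Sum>i\<le>N. sqrt_coeff i) \<le> 1"
proof (induction N)
  case 0
  then show ?case by simp
next
  case (Suc N)
  have "2 * (\<Sum>i\<le>Suc N. sqrt_coeff i) - 1
      = (\<Sum>(i, j) | i + j \<le> Suc N. sqrt_coeff i * sqrt_coeff j)"
    by (rule sqrt_coeff_triangle_sum_scalar[symmetric]) simp
  also have "\<dots> = (\<Sum>(i, j)\<in>{(i, j). i + j \<le> Suc N} \<inter> {..N} \<times> {..N}.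
      sqrt_coeff i * sqrt_coeff j)"
  proof (rule sum.mono_neutral_right[OF finite_triangle])
    show "\<forall>p\<in>{(i, j). i + j \<le> Suc N} - {(i, j). i + j \<le> Suc N} \<inter> {..N} \<times> {..N}.
        (case p of (i, j) \<Rightarrow> sqrt_coeff i * sqrt_coeff j) = 0"
    proof clarify
      fix i j :: nat assume "i + j \<le> Suc N" "(i, j) \<notin> {(i, j). i + j \<le> Suc N} \<inter> {..N} \<times> {..N}"
      then have "i = 0 \<or> j = 0" by auto
      then show "sqrt_coeff i * sqrt_coeff j = 0" by auto
    qed
  qed auto
  also have "\<dots> \<le> (\<Sum>(i, j)\<in>{..N} \<times> {..N}. sqrt_coeff i * sqrt_coeff j)"
    by (intro sum_mono2) (auto simp: sqrt_coeff_nonneg)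
  also have "\<dots> = (\<Sum>i\<le>N. sqrt_coeff i)\<^sup>2" by (rule square_sum_eq[symmetric])
  also have "\<dots> \<le> 1\<^sup>2"
    by (intro power_mono Suc.IH sum_nonneg sqrt_coeff_nonneg)
  finally show ?case by simp
qed

text \<open>The square \<open>{..N} \<times> {..N}\<close> lies in the triangle \<open>i + j \<le> 2 N\<close>, so the sum \<open>S\<close> satisfies
  \<open>S\<^sup>2 \<le> 2 S - 1\<close>, that is, \<open>(S - 1)\<^sup>2 \<le> 0\<close>.\<close>

lemma sqrt_coeff_sums_1: "sqrt_coeff sums 1"
proof -
  have sm: "summable sqrt_coeff"
  proof (rule summableI_nonneg_bounded)
    show "sum sqrt_coeff {..<n} \<le> 1" for n
    proof -
      have "sum sqrt_coeff {..<n} \<le> sum sqrt_coeff {..n}"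
        by (intro sum_mono2) (auto simp: sqrt_coeff_nonneg)
      then show ?thesis using sum_sqrt_coeff_le_1[of n] by simp
    qed
  qed (rule sqrt_coeff_nonneg)
  define S where "S = suminf sqrt_coeff"
  have lim: "(\<lambda>N. \<Sum>i\<le>N. sqrt_coeff i) \<longlonglongrightarrow> S"
    unfolding S_def by (rule summable_LIMSEQ'[OF sm])
  have "(\<lambda>N. (\<Sum>i\<le>N. sqrt_coeff i)\<^sup>2) \<longlonglongrightarrow> S\<^sup>2"
    by (intro tendsto_intros lim)
  moreover have "(\<lambda>N. 2 * (\<Sum>i\<le>2 * N. sqrt_coeff i) - 1) \<longlonglongrightarrow> 2 * S - 1"
    using LIMSEQ_subseq_LIMSEQ[OF lim, of "\<lambda>N. 2 * N"]
    by (intro tendsto_intros) (auto simp: strict_mono_def o_def)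
  moreover have "(\<Sum>i\<le>N. sqrt_coeff i)\<^sup>2 \<le> 2 * (\<Sum>i\<le>2 * N. sqrt_coeff i) - 1" if "1 \<le> N" for N
  proof -
    have "(\<Sum>i\<le>N. sqrt_coeff i)\<^sup>2
        \<le> (\<Sum>(i, j) | i + j \<le> 2 * N. sqrt_coeff i * sqrt_coeff j)"
      unfolding square_sum_eq
      by (intro sum_mono2 finite_triangle) (auto simp: sqrt_coeff_nonneg)
    then show ?thesis using sqrt_coeff_triangle_sum_scalar[of "2 * N"] that by simp
  qed
  ultimately have "S\<^sup>2 \<le> 2 * S - 1" by (intro LIMSEQ_le) auto
  then have "(S - 1)\<^sup>2 \<le> 0" by (simp add: power2_diff)
  then have "S = 1" by simp
  then show ?thesis using sm by (simp add: S_def sums_iff)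
qed

lemma summable_sqrt_coeff_scaleR:
  fixes v :: "nat \<Rightarrow> 'a::banach"
  assumes "\<And>n. norm (v n) \<le> M"
  shows "summable (\<lambda>n. sqrt_coeff n *\<^sub>R v n)"
proof (rule summable_comparison_test')
  show "summable (\<lambda>n. sqrt_coeff n * M)"
    using sqrt_coeff_sums_1 by (intro summable_mult2) (simp add: sums_iff)
  show "norm (sqrt_coeff n *\<^sub>R v n) \<le> sqrt_coeff n * M" for n
    using assms by (simp add: sqrt_coeff_nonneg mult_left_mono)
qed

text \<open>This evaluates \<open>f\<^sup>2\<close> at the boundary of the disc of convergence. For \<open>v n = t\<^sup>n\<close> it is
  \<open>f(t)\<^sup>2 = 2 f(t) - t\<close>, but \<open>v\<close> may be any bounded sequence. The square of index pairs exceeds the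
  triangle \<open>i + j \<le> N\<close> by pairs of total weight \<open>(S N)\<^sup>2 - (2 S N - 1) = (1 - S N)\<^sup>2\<close>, where \<open>S N\<close> is
  the partial sum of the coefficients, and \<open>S N\<close> tends to \<open>1\<close>.\<close>

lemma sqrt_coeff_square_sum_limit:
  fixes v :: "nat \<Rightarrow> 'a::banach"
  assumes M: "\<And>n. norm (v n) \<le> M"
  shows "(\<lambda>N. \<Sum>i\<le>N. \<Sum>j\<le>N. (sqrt_coeff i * sqrt_coeff j) *\<^sub>R v (i + j))
    \<longlonglongrightarrow> 2 *\<^sub>R (\<Sum>m. sqrt_coeff m *\<^sub>R v m) - v 1"
proof -
  let ?f = "\<lambda>(i, j). (sqrt_coeff i * sqrt_coeff j) *\<^sub>R v (i + j)"
  let ?c = "\<lambda>(i, j). sqrt_coeff i * sqrt_coeff j"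
  let ?S = "\<lambda>N. \<Sum>i\<le>N. sqrt_coeff i"
  let ?t = "\<lambda>N. 2 *\<^sub>R (\<Sum>m\<le>N. sqrt_coeff m *\<^sub>R v m) - v 1"
  have lim: "?t \<longlonglongrightarrow> 2 *\<^sub>R (\<Sum>m. sqrt_coeff m *\<^sub>R v m) - v 1"
    by (intro tendsto_intros summable_LIMSEQ' summable_sqrt_coeff_scaleR[OF M])
  have est: "norm ((\<Sum>i\<le>N. \<Sum>j\<le>N. (sqrt_coeff i * sqrt_coeff j) *\<^sub>R v (i + j)) - ?t N)
      \<le> (1 - ?S N)\<^sup>2 * M" if N: "1 \<le> N" for N
  proof -
    let ?Q = "{..N} \<times> {..N}" and ?T = "{(i, j). i + j \<le> N}"
    have sub: "?T \<subseteq> ?Q" by auto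
    have "(\<Sum>i\<le>N. \<Sum>j\<le>N. (sqrt_coeff i * sqrt_coeff j) *\<^sub>R v (i + j)) - ?t N
        = sum ?f ?Q - sum ?f ?T"
      using sqrt_coeff_triangle_sum[OF N, of v] by (simp add: sum.cartesian_product)
    also have "\<dots> = sum ?f (?Q - ?T)"
      using sum_diff[of ?Q ?T ?f] sub by simp
    also have "norm \<dots> \<le> (\<Sum>p\<in>?Q - ?T. ?c p * M)"
      by (intro sum_norm_le) (auto simp: sqrt_coeff_nonneg M intro!: mult_left_mono)
    also have "\<dots> = (sum ?c ?Q - sum ?c ?T) * M"
      unfolding sum_distrib_right[symmetric] using sum_diff[of ?Q ?T ?c] sub by simp
    also have "\<dots> = ((?S N)\<^sup>2 - (2 * ?S N - 1)) * M"
      unfolding square_sum_eq sqrt_coeff_triangle_sum_scalar[OF N] ..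
    also have "\<dots> = (1 - ?S N)\<^sup>2 * M" by (simp add: power2_diff algebra_simps)
    finally show ?thesis .
  qed
  have "(\<lambda>N. (1 - ?S N)\<^sup>2 * M) \<longlonglongrightarrow> (1 - 1)\<^sup>2 * M"
    using sqrt_coeff_sums_1 by (intro tendsto_intros) (simp add: sums_def_le)
  then have "(\<lambda>N. (\<Sum>i\<le>N. \<Sum>j\<le>N. (sqrt_coeff i * sqrt_coeff j) *\<^sub>R v (i + j)) - ?t N) \<longlonglongrightarrow> 0"
    by (intro Lim_null_comparison[OF eventually_sequentiallyI[of 1, OF est]]) auto
  from tendsto_add[OF this lim] show ?thesis by simp
qed

section \<open>C*-algebras\<close>

lemma scaleC_one [simp]: "1 *\<^sub>C x = (x :: 'a::complex_normed_vector)"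
  using scaleR_scaleC[of 1 x] by simp

lemma star_scaleR: "star (r *\<^sub>R x) = r *\<^sub>R star (x :: 'a::cstar_algebra)"
  by (simp add: scaleR_scaleC star_scaleC)

lemma star_zero [simp]: "star (0 :: 'a::cstar_algebra) = 0"
  using star_scaleR[of 0 "0 :: 'a"] by simp

lemma star_minus: "star (- x) = - star (x :: 'a::cstar_algebra)"
  using star_scaleR[of "- 1" x] by simp

lemma star_diff: "star (x - y) = star x - star (y :: 'a::cstar_algebra)"
  using star_add[of x "- y"] by (simp add: star_minus)

lemma norm_le_norm_star: "norm x \<le> norm (star (x :: 'a::cstar_algebra))"
proof (cases "norm x = 0")
  case False
  have "norm x * norm x \<le> norm (star x) * norm x"
    using norm_mult_ineq[of "star x" x] norm_star_mult_self[of x] by (simp add: power2_eq_square)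
  then show ?thesis using False by simp
qed simp

lemma norm_star [simp]: "norm (star x) = norm (x :: 'a::cstar_algebra)"
  using norm_le_norm_star[of x] norm_le_norm_star[of "star x"] by (simp add: star_star)

lemma bounded_linear_star: "bounded_linear (star :: 'a::cstar_algebra \<Rightarrow> 'a)"
  by (rule bounded_linear_intro[where K = 1]) (simp_all add: star_add star_scaleR)

lemma norm_eqI_star_mult:
  assumes "star x * x = star y * (y :: 'a::cstar_algebra)"
  shows "norm x = norm y"
  using norm_star_mult_self[of x] norm_star_mult_self[of y] assms by simp

lemma norm_le_by_left_mult:
  assumes "0 \<le> K" "\<And>x. norm (d * x) \<le> K * norm (x :: 'a::cstar_algebra)"
  shows "norm d \<le> K"
proof (cases "norm d = 0")
  case False
  have "norm d * norm d = norm (d * star d)"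
    using norm_star_mult_self[of "star d"] by (simp add: star_star power2_eq_square)
  also have "\<dots> \<le> K * norm d" using assms(2)[of "star d"] by simp
  finally show ?thesis using False by simp
qed (use assms in simp)

section \<open>Square roots\<close>

text \<open>\<open>pow_Suc b n\<close> is \<open>b\<^bsup>n+1\<^esup>\<close>; without a unit there is no power with exponent zero.\<close>

primrec pow_Suc :: "'a::semigroup_mult \<Rightarrow> nat \<Rightarrow> 'a" where
  "pow_Suc b 0 = b"
| "pow_Suc b (Suc n) = b * pow_Suc b n"

lemma pow_Suc_add: "pow_Suc b m * pow_Suc b n = pow_Suc b (Suc (m + n))"
  by (induction m) (simp_all add: mult.assoc)

lemma pow_Suc_commute: "h * b = b * h \<Longrightarrow> h * pow_Suc b n = pow_Suc b n * h"
proof (induction n)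
  case (Suc n)
  have "h * pow_Suc b (Suc n) = b * (h * pow_Suc b n)"
    using Suc.prems by (simp add: mult.assoc[symmetric])
  then show ?case using Suc by (simp add: mult.assoc)
qed simp

lemma star_pow_Suc:
  fixes b :: "'a::cstar_algebra"
  assumes "star b = b"
  shows "star (pow_Suc b n) = pow_Suc b n"
proof (induction n)
  case (Suc n)
  then show ?case using pow_Suc_commute[of b b n] by (simp add: star_mult assms)
qed (use assms in simp)

lemma norm_pow_Suc_le_1:
  fixes b :: "'a::real_normed_algebra"
  assumes "norm b \<le> 1"
  shows "norm (pow_Suc b n) \<le> 1"
proof (induction n)
  case (Suc n)
  have "norm (pow_Suc b (Suc n)) \<le> norm b * norm (pow_Suc b n)" by (simp add: norm_mult_ineq)
  also have "\<dots> \<le> 1 * 1" by (intro mult_mono assms Suc) auto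
  finally show ?case by simp
qed (use assms in simp)

text \<open>The element \<open>s = \<Sum>n. sqrt_coeff n *\<^sub>R b\<^sup>n\<close> stands for \<open>1 - sqrt (1 - b)\<close>: its defining identity says
  \<open>(1 - s)\<^sup>2 = 1 - b\<close> without mentioning the unit. The series converges on the whole closed unit ball
  because the coefficients are summable.\<close>

lemma sqrt_one_minus:
  fixes b :: "'a::cstar_algebra"
  assumes sa: "star b = b" and nb: "norm b \<le> 1"
  obtains s where "star s = s" "s * s = 2 *\<^sub>R s - b" "\<And>h. h * b = b * h \<Longrightarrow> h * s = s * h"
proof
  define e where "e n = (case n of 0 \<Rightarrow> 0 | Suc m \<Rightarrow> pow_Suc b m)" for n
  define s where "s = (\<Sum>n. sqrt_coeff n *\<^sub>R e n)"
  have e_norm: "norm (e n) \<le> 1" for n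
    by (simp add: e_def norm_pow_Suc_le_1[OF nb] split: nat.split)
  have sm: "summable (\<lambda>n. sqrt_coeff n *\<^sub>R e n)"
    by (rule summable_sqrt_coeff_scaleR[OF e_norm])
  show "star s = s"
    unfolding s_def bounded_linear.suminf[OF bounded_linear_star sm]
    by (intro suminf_cong) (simp add: star_scaleR e_def star_pow_Suc[OF sa] split: nat.split)
  show "h * s = s * h" if "h * b = b * h" for h
    unfolding s_def suminf_mult[OF sm, symmetric] suminf_mult2[OF sm]
    by (intro suminf_cong) (simp add: e_def pow_Suc_commute[OF that] split: nat.split)
  have "(sqrt_coeff i *\<^sub>R e i) * (sqrt_coeff j *\<^sub>R e j)
      = (sqrt_coeff i * sqrt_coeff j) *\<^sub>R e (i + j)" for i j
    by (cases i; cases j) (auto simp: e_def pow_Suc_add)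
  then have "(\<Sum>i\<le>N. sqrt_coeff i *\<^sub>R e i) * (\<Sum>j\<le>N. sqrt_coeff j *\<^sub>R e j)
      = (\<Sum>i\<le>N. \<Sum>j\<le>N. (sqrt_coeff i * sqrt_coeff j) *\<^sub>R e (i + j))" for N
    unfolding sum_product by simp
  then have "(\<lambda>N. (\<Sum>i\<le>N. sqrt_coeff i *\<^sub>R e i) * (\<Sum>j\<le>N. sqrt_coeff j *\<^sub>R e j))
      \<longlonglongrightarrow> 2 *\<^sub>R s - e 1"
    unfolding s_def using sqrt_coeff_square_sum_limit[OF e_norm] by simp
  moreover have "(\<lambda>N. (\<Sum>i\<le>N. sqrt_coeff i *\<^sub>R e i) * (\<Sum>j\<le>N. sqrt_coeff j *\<^sub>R e j))
      \<longlonglongrightarrow> s * s"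
    unfolding s_def by (intro tendsto_intros summable_LIMSEQ' sm)
  ultimately have "s * s = 2 *\<^sub>R s - e 1" by (rule LIMSEQ_unique[rotated])
  then show "s * s = 2 *\<^sub>R s - b" by (simp add: e_def)
qed

text \<open>Choose \<open>s\<close> with \<open>(1 - s)\<^sup>2 = 1 - h\<^sup>2\<close>. As \<open>s\<close> commutes with \<open>h\<close>, the formal elements
  \<open>h \<plusminus> i (1 - s)\<close> are unitary, so left multiplication by them is isometric. Hence left multiplication by
  \<open>1 - s\<close>, half of their difference up to the factor \<open>i\<close>, is contractive, and so is its square.\<close>

lemma norm_one_minus_square_le:
  fixes h :: "'a::cstar_algebra"
  assumes sa: "star h = h" and nh: "norm h \<le> 1"
  shows "norm (x - h * h * x) \<le> norm x"
proof -
  have "norm (h * h) \<le> 1"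
    using norm_star_mult_self[of h] nh by (simp add: sa power_le_one)
  moreover have "star (h * h) = h * h" by (simp add: star_mult sa)
  ultimately obtain s where s: "star s = s" "s * s = 2 *\<^sub>R s - h * h"
    and comm: "\<And>k. k * (h * h) = h * h * k \<Longrightarrow> k * s = s * k"
    using sqrt_one_minus by metis
  have hs: "h * s = s * h" by (rule comm) (simp add: mult.assoc)
  have i: "\<i> *\<^sub>C \<i> *\<^sub>C y = - y" "(- \<i>) *\<^sub>C y = - (\<i> *\<^sub>C y)" for y :: 'a
    using scaleR_scaleC[of "- 1" y] scaleC_scaleC[of "- 1" "\<i>" y] scaleR_scaleC[of "- 1" "\<i> *\<^sub>C y"]
    by (simp_all add: scaleC_scaleC)
  have iso: "norm (h * y + c *\<^sub>C (y - s * y)) = norm y" if c: "c = \<i> \<or> c = - \<i>" for y c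
  proof (rule norm_eqI_star_mult)
    have cc: "cnj c *\<^sub>C c *\<^sub>C z = z" for z :: 'a using c by (auto simp: scaleC_scaleC)
    have cn: "cnj c *\<^sub>C z = - (c *\<^sub>C z)" for z :: 'a using c i(2) by auto
    have expand: "(P + cnj c *\<^sub>C U) * (Q + c *\<^sub>C V) = P * Q + c *\<^sub>C (P * V - U * Q) + U * V"
      for P Q U V :: 'a
    proof -
      have "(P + cnj c *\<^sub>C U) * (Q + c *\<^sub>C V)
          = P * Q + c *\<^sub>C (P * V) + cnj c *\<^sub>C (U * Q) + (cnj c * c) *\<^sub>C (U * V)"
        by (simp only: distrib_left distrib_right mult_scaleC_left mult_scaleC_right
            scaleC_add_right scaleC_scaleC mult.commute[of c "cnj c"] add_ac)
      then show ?thesis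
        unfolding scaleC_scaleC[symmetric] cc unfolding cn by (simp add: scaleC_diff_right)
    qed
    let ?y = "star y"
    have "star (h * y + c *\<^sub>C (y - s * y)) * (h * y + c *\<^sub>C (y - s * y))
        = (?y * h + cnj c *\<^sub>C (?y - ?y * s)) * (h * y + c *\<^sub>C (y - s * y))"
      by (simp add: star_add star_scaleC star_diff star_mult sa s(1))
    also have "\<dots> = ?y * h * (h * y) + c *\<^sub>C (?y * h * (y - s * y) - (?y - ?y * s) * (h * y))
        + (?y - ?y * s) * (y - s * y)"
      by (rule expand)
    also have "?y * h * (y - s * y) - (?y - ?y * s) * (h * y) = ?y * (s * h - h * s) * y"
      by (simp add: algebra_simps)
    also have "\<dots> = 0" by (simp add: hs)
    also have "?y * h * (h * y) + c *\<^sub>C 0 + (?y - ?y * s) * (y - s * y)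
        = ?y * (h * h + s * s - 2 *\<^sub>R s) * y + ?y * y"
      by (simp add: algebra_simps scaleR_2)
    also have "\<dots> = ?y * y" by (simp add: s(2))
    finally show "star (h * y + c *\<^sub>C (y - s * y)) * (h * y + c *\<^sub>C (y - s * y)) = star y * y" .
  qed
  have contr: "norm (y - s * y) \<le> norm y" for y
  proof -
    have "(h * y + \<i> *\<^sub>C (y - s * y)) - (h * y + (- \<i>) *\<^sub>C (y - s * y))
        = \<i> *\<^sub>C (y - s * y) + \<i> *\<^sub>C (y - s * y)"
      by (simp add: i(2))
    also have "\<dots> = (2 * \<i>) *\<^sub>C (y - s * y)"
      by (simp add: scaleC_add_left[symmetric])
    finally have "2 * norm (y - s * y)
        = norm ((h * y + \<i> *\<^sub>C (y - s * y)) - (h * y + (- \<i>) *\<^sub>C (y - s * y)))"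
      by (simp add: norm_scaleC norm_mult)
    also have "\<dots> \<le> norm y + norm y"
      using norm_triangle_ineq4[of "h * y + \<i> *\<^sub>C (y - s * y)" "h * y + (- \<i>) *\<^sub>C (y - s * y)"]
      by (simp add: iso)
    finally show ?thesis by simp
  qed
  have "x - h * h * x = (x - s * x) - s * (x - s * x)"
  proof -
    have "s * (s * x) = (2 *\<^sub>R s - h * h) * x" by (simp add: s(2)[symmetric] mult.assoc)
    then show ?thesis by (simp add: algebra_simps scaleR_2)
  qed
  then have "norm (x - h * h * x) \<le> norm (x - s * x)"
    using contr[of "x - s * x"] by (simp only:)
  also have "\<dots> \<le> norm x" by (rule contr)
  finally show ?thesis .
qed

text \<open>\<open>one_minus_pow a n\<close> is \<open>1 - (1 - a)\<^sup>n\<close>, which lies in the algebra even if \<open>1\<close> does not.\<close>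

primrec one_minus_pow :: "'a::ring \<Rightarrow> nat \<Rightarrow> 'a" where
  "one_minus_pow a 0 = 0"
| "one_minus_pow a (Suc n) = one_minus_pow a n + a - a * one_minus_pow a n"

lemma one_minus_pow_commute: "one_minus_pow a n * a = a * one_minus_pow a n"
  by (induction n) (simp_all add: algebra_simps)

lemma one_minus_pow_mult:
  "one_minus_pow a m * one_minus_pow a n
    = one_minus_pow a m + one_minus_pow a n - one_minus_pow a (m + n)"
proof (induction m)
  case (Suc m)
  have "one_minus_pow a (Suc m) * one_minus_pow a n
      = one_minus_pow a m * one_minus_pow a n + a * one_minus_pow a n
        - a * (one_minus_pow a m * one_minus_pow a n)"
    by (simp add: algebra_simps)
  then show ?case unfolding Suc by (simp add: algebra_simps)
qed simp

lemma star_one_minus_pow: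
  fixes a :: "'a::cstar_algebra"
  assumes "star a = a"
  shows "star (one_minus_pow a n) = one_minus_pow a n"
  by (induction n) (simp_all add: star_add star_diff star_mult assms one_minus_pow_commute)

text \<open>The contractivity of \<open>1 - a\<close> is the norm form of \<open>0 \<le> a \<le> 2\<close>. The square root of
  \<open>a = 1 - (1 - a)\<close> is \<open>1 - (\<Sum>n. sqrt_coeff n *\<^sub>R (1 - a)\<^sup>n)\<close>. Because the coefficients sum to exactly \<open>1\<close>, this
  equals \<open>\<Sum>n. sqrt_coeff n *\<^sub>R (1 - (1 - a)\<^sup>n)\<close>, a series inside the algebra.\<close>

lemma sqrt_of_contractive_complement:
  fixes a :: "'a::cstar_algebra"
  assumes sa: "star a = a" and contr: "\<And>x. norm (x - a * x) \<le> norm x"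
  obtains z where "star z = z" "z * z = a"
proof
  define d where "d = one_minus_pow a"
  define z where "z = (\<Sum>n. sqrt_coeff n *\<^sub>R d n)"
  have d_contr: "norm (x - d n * x) \<le> norm x" for n x
  proof (induction n)
    case (Suc n)
    have "x - d (Suc n) * x = (x - d n * x) - a * (x - d n * x)"
      by (simp add: d_def algebra_simps)
    then have "norm (x - d (Suc n) * x) \<le> norm (x - d n * x)"
      using contr[of "x - d n * x"] by (simp only:)
    then show ?case using Suc by (rule order_trans)
  qed (simp add: d_def)
  have d_norm: "norm (d n) \<le> 2" for n
  proof (rule norm_le_by_left_mult)
    fix x
    have "norm (x - (x - d n * x)) \<le> norm x + norm (x - d n * x)" by (rule norm_triangle_ineq4)
    also have "\<dots> \<le> norm x + norm x" by (intro add_left_mono d_contr)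
    finally show "norm (d n * x) \<le> 2 * norm x" by simp
  qed simp
  have sm: "summable (\<lambda>n. sqrt_coeff n *\<^sub>R d n)"
    by (rule summable_sqrt_coeff_scaleR[OF d_norm])
  show "star z = z"
    unfolding z_def bounded_linear.suminf[OF bounded_linear_star sm]
    by (intro suminf_cong) (simp add: star_scaleR d_def star_one_minus_pow[OF sa])
  let ?c = sqrt_coeff
  let ?Z = "\<lambda>N. \<Sum>i\<le>N. ?c i *\<^sub>R d i" and ?S = "\<lambda>N. \<Sum>i\<le>N. ?c i"
  have Z: "?Z \<longlonglongrightarrow> z" unfolding z_def by (rule summable_LIMSEQ'[OF sm])
  have S: "?S \<longlonglongrightarrow> 1" using sqrt_coeff_sums_1 by (simp add: sums_def_le)
  have "?Z N * ?Z N = 2 *\<^sub>R (?S N *\<^sub>R ?Z N)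
      - (\<Sum>i\<le>N. \<Sum>j\<le>N. (?c i * ?c j) *\<^sub>R d (i + j))" for N
  proof -
    have "?Z N * ?Z N = (\<Sum>i\<le>N. \<Sum>j\<le>N. (?c j * ?c i) *\<^sub>R d i + (?c i * ?c j) *\<^sub>R d j
        - (?c i * ?c j) *\<^sub>R d (i + j))"
      unfolding sum_product
      by (intro sum.cong)
        (simp_all add: d_def one_minus_pow_mult scaleR_add_right scaleR_diff_right mult.commute)
    also have "\<dots> = (\<Sum>i\<le>N. \<Sum>j\<le>N. (?c j * ?c i) *\<^sub>R d i)
        + (\<Sum>i\<le>N. \<Sum>j\<le>N. (?c i * ?c j) *\<^sub>R d j)
        - (\<Sum>i\<le>N. \<Sum>j\<le>N. (?c i * ?c j) *\<^sub>R d (i + j))"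
      by (simp only: sum.distrib sum_subtractf)
    also have "(\<Sum>i\<le>N. \<Sum>j\<le>N. (?c i * ?c j) *\<^sub>R d j)
        = (\<Sum>i\<le>N. \<Sum>j\<le>N. (?c j * ?c i) *\<^sub>R d i)"
      by (rule sum.swap)
    also have "(\<Sum>i\<le>N. \<Sum>j\<le>N. (?c j * ?c i) *\<^sub>R d i) = ?S N *\<^sub>R ?Z N"
      by (simp add: scaleR_sum_right scaleR_sum_left[symmetric] sum_distrib_right[symmetric])
    finally show ?thesis unfolding scaleR_2 .
  qed
  then have "(\<lambda>N. ?Z N * ?Z N) \<longlonglongrightarrow> 2 *\<^sub>R (1 *\<^sub>R z) - (2 *\<^sub>R z - d 1)"
    using tendsto_diff[OF tendsto_scaleR[OF tendsto_const tendsto_scaleR[OF S Z]]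
        sqrt_coeff_square_sum_limit[of d 2, OF d_norm], of 2]
    by (simp add: z_def)
  moreover have "(\<lambda>N. ?Z N * ?Z N) \<longlonglongrightarrow> z * z" by (intro tendsto_intros Z)
  ultimately have "z * z = 2 *\<^sub>R (1 *\<^sub>R z) - (2 *\<^sub>R z - d 1)" by (rule LIMSEQ_unique[rotated])
  then show "z * z = a" by (simp add: d_def)
qed

text \<open>Contractivity of \<open>1 - a\<close> is preserved by infinite convex combinations, while being a square is
  not visibly so; hence the detour through contractivity.\<close>

lemma sqrt_of_convex_series_of_squares:
  fixes h :: "nat \<Rightarrow> 'a::cstar_algebra"
  assumes sa: "\<And>n. star (h n) = h n" and nh: "\<And>n. norm (h n) \<le> 1"
    and w: "\<And>n. 0 \<le> w n" "w sums 1"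
  obtains z where "star z = z" "z * z = (\<Sum>n. w n *\<^sub>R (h n * h n))"
proof -
  let ?a = "\<Sum>n. w n *\<^sub>R (h n * h n)"
  have "norm (h n * h n) \<le> 1" for n
    using norm_star_mult_self[of "h n"] nh[of n] by (simp add: sa power_le_one)
  then have sm: "summable (\<lambda>n. w n *\<^sub>R (h n * h n))"
    by (intro summable_comparison_test'[OF sums_summable[OF w(2)]])
      (simp add: w(1) mult_left_le)
  have "star ?a = ?a"
    unfolding bounded_linear.suminf[OF bounded_linear_star sm]
    by (intro suminf_cong) (simp add: star_scaleR star_mult sa)
  moreover have "norm (x - ?a * x) \<le> norm x" for x
  proof -
    have "(\<lambda>n. w n *\<^sub>R x - w n *\<^sub>R (h n * h n) * x) sums (1 *\<^sub>R x - ?a * x)"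
      by (rule sums_diff[OF sums_scaleR_left[OF w(2)] sums_mult2[OF summable_sums[OF sm]]])
    then have *: "(\<lambda>n. w n *\<^sub>R (x - h n * h n * x)) sums (x - ?a * x)"
      by (simp add: scaleR_diff_right)
    have le: "norm (w n *\<^sub>R (x - h n * h n * x)) \<le> w n * norm x" for n
      using norm_one_minus_square_le[OF sa nh] by (simp add: w(1) mult_left_mono)
    have "(\<lambda>n. w n * norm x) sums (1 * norm x)" by (rule sums_mult2[OF w(2)])
    then show ?thesis using norm_sums_le[OF * _ le] by simp
  qed
  ultimately obtain z where "star z = z" "z * z = ?a"
    by (rule sqrt_of_contractive_complement)
  then show thesis by (rule that)
qed

section \<open>Automatic continuity\<close>

lemma inner_star_mult_self:
  "inner (bop_apply (star T * T) x) x = (norm (bop_apply T x))\<^sup>2"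
proof -
  have "cinner (bop_apply (star T * T) x) x = cinner (bop_apply T x) (bop_apply T x)"
    using cinner_star[of "star T" "bop_apply T x" x] by (simp add: star_star)
  then show ?thesis by (simp add: inner_eq_Re_cinner power2_norm_eq_inner)
qed

text \<open>With \<open>P = S* S\<close>, the form \<open>\<langle>P x, x\<rangle> = \<parallel>S x\<parallel>\<^sup>2\<close> is dominated by \<open>\<langle>(P + Q) x, x\<rangle>\<close>; this bounds
  \<open>\<parallel>S\<parallel>\<^sup>2 = \<parallel>P\<parallel>\<close>.\<close>

lemma norm_le_norm_add_positive:
  assumes "P \<in> pos_elems UNIV" "Q \<in> pos_elems (UNIV :: 'h::chilbert_space bop set)"
  shows "norm P \<le> norm (P + Q)"
proof -
  obtain S T where P: "P = star S * S" and Q: "Q = star T * T"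
    using assms by (auto simp: pos_elems_def)
  have "norm S \<le> sqrt (norm (P + Q))"
  proof (rule bop_norm_bound)
    fix x
    have "(norm (bop_apply S x))\<^sup>2 \<le> inner (bop_apply (P + Q) x) x"
      using inner_star_mult_self[of S x] inner_star_mult_self[of T x]
      by (simp add: P Q bop_apply_simps inner_add_left)
    also have "\<dots> \<le> norm (bop_apply (P + Q) x) * norm x" by (rule norm_cauchy_schwarz)
    also have "\<dots> \<le> norm (P + Q) * norm x * norm x"
      by (intro mult_right_mono bop_norm_apply) simp
    also have "\<dots> = (sqrt (norm (P + Q)) * norm x)\<^sup>2"
      by (simp add: power_mult_distrib power2_eq_square mult_ac)
    finally show "norm (bop_apply S x) \<le> sqrt (norm (P + Q)) * norm x"
      by (rule power2_le_imp_le) simp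
  qed simp
  then have "(norm S)\<^sup>2 \<le> (sqrt (norm (P + Q)))\<^sup>2" by (intro power_mono) auto
  then show ?thesis by (simp add: P norm_star_mult_self)
qed

lemma clinear_scaleR: "clinear f \<Longrightarrow> f (r *\<^sub>R x) = r *\<^sub>R f x"
  by (simp add: clinear_iff scaleR_scaleC)

text \<open>If \<open>\<phi>\<close> took self-adjoint \<open>h n\<close> in the unit ball to \<open>\<phi> (h n * h n)\<close> of norm larger than \<open>4 ^ n\<close>, put
  \<open>c = \<Sum>k. 2\<^bsup>-k-1\<^esup> *\<^sub>R (h k * h k)\<close>. Deleting the \<open>n\<close>-th term of \<open>c\<close> leaves a series of the same kind, hence
  a square, so positivity alone gives that \<open>\<phi> c\<close> dominates \<open>2\<^bsup>-n-1\<^esup> *\<^sub>R \<phi> (h n * h n)\<close> for every \<open>n\<close>, and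
  \<open>\<parallel>\<phi> c\<parallel>\<close> would be infinite.\<close>

lemma positive_map_bounded_on_selfadjoint_squares:
  fixes \<phi> :: "'a::cstar_algebra \<Rightarrow> 'h::chilbert_space bop"
  assumes lin: "clinear \<phi>" and pos: "\<And>y. \<phi> (star y * y) \<in> pos_elems UNIV"
  shows "\<exists>K. \<forall>h. star h = h \<longrightarrow> norm h \<le> 1 \<longrightarrow> norm (\<phi> (h * h)) \<le> K"
proof (rule ccontr)
  assume "\<not> ?thesis"
  then have "\<exists>h. star h = h \<and> norm h \<le> 1 \<and> 4 ^ n < norm (\<phi> (h * h))" for n :: nat
    by (meson not_le)
  then obtain h where h: "star (h n) = h n" "norm (h n) \<le> 1" "4 ^ n < norm (\<phi> (h n * h n))"
    for n :: nat by metis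
  define w :: "nat \<Rightarrow> real" where "w n = (1 / 2) ^ Suc n" for n
  have w: "0 \<le> w n" "w sums 1" for n
    unfolding w_def using power_half_series by (simp_all add: w_def)
  define c where "c = (\<Sum>k. w k *\<^sub>R (h k * h k))"
  have sm: "summable (\<lambda>k. w k *\<^sub>R (h k * h k))"
  proof (rule summable_comparison_test'[OF sums_summable[OF w(2)]])
    show "norm (w k *\<^sub>R (h k * h k)) \<le> w k" for k
      using norm_star_mult_self[of "h k"] h(2)[of k]
      by (simp add: h(1) w(1) mult_left_le power_le_one)
  qed
  have add: "\<phi> (x + y) = \<phi> x + \<phi> y" for x y using lin by (simp add: clinear_iff)
  have "w n * 4 ^ n \<le> norm (\<phi> c)" for n
  proof -
    \<comment> \<open>Replacing \<open>h n\<close> by \<open>0\<close>, and not the weight \<open>w n\<close>, keeps the total weight at \<open>1\<close>.\<close>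
    define g where "g k = (if k = n then 0 else h k)" for k
    have "star (g k) = g k" "norm (g k) \<le> 1" for k by (auto simp: g_def h)
    then obtain z where z: "star z = z" "z * z = (\<Sum>k. w k *\<^sub>R (g k * g k))"
      using sqrt_of_convex_series_of_squares w by metis
    have "(\<lambda>k. w k *\<^sub>R (h k * h k) - (if k = n then w k *\<^sub>R (h k * h k) else 0))
        sums (c - w n *\<^sub>R (h n * h n))"
      unfolding c_def by (intro sums_diff summable_sums[OF sm] sums_single)
    also have "(\<lambda>k. w k *\<^sub>R (h k * h k) - (if k = n then w k *\<^sub>R (h k * h k) else 0))
        = (\<lambda>k. w k *\<^sub>R (g k * g k))"
      by (auto simp: g_def)
    finally have "c - w n *\<^sub>R (h n * h n) = z * z" by (simp add: z(2) sums_iff)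
    then have split: "c = w n *\<^sub>R (h n * h n) + star z * z" by (simp add: z(1) algebra_simps)
    have "\<phi> (w n *\<^sub>R (h n * h n)) \<in> pos_elems UNIV"
      using pos[of "sqrt (w n) *\<^sub>R h n"] by (simp add: star_scaleR h(1) w(1))
    then have "norm (\<phi> (w n *\<^sub>R (h n * h n))) \<le> norm (\<phi> c)"
      unfolding split add using norm_le_norm_add_positive pos by blast
    moreover have "w n * 4 ^ n \<le> w n * norm (\<phi> (h n * h n))"
      using h(3)[of n] w(1)[of n] by (intro mult_left_mono) auto
    ultimately show ?thesis by (simp add: clinear_scaleR[OF lin] w(1))
  qed
  moreover obtain n where "2 * norm (\<phi> c) < 2 ^ n" using real_arch_pow[of 2] by auto
  moreover have "w n * 4 ^ n = 2 ^ n / 2"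
    by (simp add: w_def power_divide) (simp add: power_mult_distrib[symmetric] field_simps)
  ultimately show False by (metis (no_types, opaque_lifting) field_sum_of_halves
      less_divide_eq_numeral1(1) mult.commute not_le)
qed

text \<open>For \<open>y = p - i q\<close> with \<open>p\<close>, \<open>q\<close> self-adjoint, \<open>y* y + y y* = 2 p\<^sup>2 + 2 q\<^sup>2\<close>. Since \<open>\<phi> (y y*)\<close> is
  positive, \<open>\<phi> (y* y)\<close> is dominated by \<open>2 \<phi> (p\<^sup>2) + 2 \<phi> (q\<^sup>2)\<close>, so a bound on squares of self-adjoint
  elements suffices. This avoids taking the square root of \<open>y* y\<close>, which would require
  the spectrum of \<open>y* y\<close> to be nonnegative.\<close>

lemma positive_map_bounded:
  fixes \<phi> :: "'a::cstar_algebra \<Rightarrow> 'h::chilbert_space bop"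
  assumes lin: "clinear \<phi>" and pos: "\<And>y. \<phi> (star y * y) \<in> pos_elems UNIV"
  shows "\<exists>K\<ge>0. \<forall>y. norm (\<phi> (star y * y)) \<le> K * norm (star y * y)"
proof -
  obtain K where K: "star h = h \<Longrightarrow> norm h \<le> 1 \<Longrightarrow> norm (\<phi> (h * h)) \<le> K" for h
    using positive_map_bounded_on_selfadjoint_squares[OF assms] by blast
  have K0: "0 \<le> K" using K[of 0] order_trans[OF norm_ge_zero] by auto
  have add: "\<phi> (x + y) = \<phi> x + \<phi> y" for x y using lin by (simp add: clinear_iff)
  have sq: "norm (\<phi> (h * h)) \<le> K * (norm h)\<^sup>2" if sa: "star h = h" for h
  proof (cases "h = 0")
    case True
    then show ?thesis using clinear_scaleR[OF lin, of 0 0] by simp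
  next
    case False
    let ?g = "inverse (norm h) *\<^sub>R h"
    have "norm (\<phi> (?g * ?g)) \<le> K" by (rule K) (use False in \<open>simp_all add: star_scaleR sa\<close>)
    then have "norm (\<phi> (h * h)) / (norm h)\<^sup>2 \<le> K"
      by (simp add: clinear_scaleR[OF lin] power2_eq_square divide_inverse mult_ac)
    then show ?thesis using False by (simp add: pos_divide_le_eq)
  qed
  have "norm (\<phi> (star y * y)) \<le> (4 * K) * norm (star y * y)" for y
  proof -
    define p where "p = (1 / 2) *\<^sub>R (y + star y)"
    define q where "q = (1 / 2) *\<^sub>R (\<i> *\<^sub>C (y - star y))"
    have sa: "star p = p" "star q = q"
      using scaleR_scaleC[of "-1" "\<i> *\<^sub>C (star y - y)"]
      by (simp_all add: p_def q_def star_scaleR star_add star_diff star_star star_scaleC add.commute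
          scaleC_scaleC scaleC_diff_right)
    have np: "norm p \<le> norm y" "norm q \<le> norm y"
      using norm_triangle_ineq[of y "star y"] norm_triangle_ineq4[of y "star y"]
      by (simp_all add: p_def q_def norm_scaleC)
    have ii: "\<i> *\<^sub>C \<i> *\<^sub>C x = - x" for x :: 'a
      using scaleR_scaleC[of "-1" x] by (simp add: scaleC_scaleC)
    have "star y * y + star (star y) * star y = 2 *\<^sub>R (p * p) + 2 *\<^sub>R (q * q)"
    proof -
      have "4 *\<^sub>R (p * p) = (y + star y) * (y + star y)" by (simp add: p_def)
      moreover have "4 *\<^sub>R (q * q) = - ((y - star y) * (y - star y))"
        by (simp add: q_def mult_scaleC_left mult_scaleC_right scaleC_scaleR_commute ii)
      ultimately have "4 *\<^sub>R (p * p) + 4 *\<^sub>R (q * q) = 2 *\<^sub>R (star y * y + y * star y)"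
        by (simp add: algebra_simps scaleR_2)
      then have "(1/2) *\<^sub>R (4 *\<^sub>R (p * p) + 4 *\<^sub>R (q * q)) = (1/2) *\<^sub>R (2 *\<^sub>R (star y * y + y * star y))"
        by simp
      then show ?thesis by (simp add: scaleR_add_right star_star)
    qed
    then have "\<phi> (star y * y) + \<phi> (star (star y) * star y)
        = 2 *\<^sub>R \<phi> (p * p) + 2 *\<^sub>R \<phi> (q * q)"
      unfolding add[symmetric] clinear_scaleR[OF lin, symmetric] by simp
    then have "norm (\<phi> (star y * y)) \<le> norm (2 *\<^sub>R \<phi> (p * p) + 2 *\<^sub>R \<phi> (q * q))"
      using norm_le_norm_add_positive[OF pos[of y] pos[of "star y"]] by simp
    also have "\<dots> \<le> 2 * norm (\<phi> (p * p)) + 2 * norm (\<phi> (q * q))"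
      by (rule norm_triangle_le) simp
    also have "\<dots> \<le> 2 * (K * (norm p)\<^sup>2) + 2 * (K * (norm q)\<^sup>2)"
      by (intro add_mono mult_left_mono sq sa) auto
    also have "\<dots> \<le> 2 * (K * (norm y)\<^sup>2) + 2 * (K * (norm y)\<^sup>2)"
      by (intro add_mono mult_left_mono power_mono np K0) auto
    finally show ?thesis by (simp add: norm_star_mult_self)
  qed
  then show ?thesis using K0 by (intro exI[of _ "4 * K"]) auto
qed

section \<open>Completely positive maps\<close>

lemma mat_alg_iff:
  "X \<in> mat_alg n S \<longleftrightarrow> dim_row X = n \<and> dim_col X = n \<and> (\<forall>i<n. \<forall>j<n. X $$ (i, j) \<in> S)"
  by (auto simp: mat_alg_def dest: elements_matD intro: elements_matI)

lemma completely_positive_pos_elems: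
  assumes "completely_positive T \<phi>" "X \<in> pos_elems UNIV"
  shows "\<phi> X \<in> pos_elems T"
proof -
  obtain y where y: "X = star y * y" using assms(2) by (auto simp: pos_elems_def)
  let ?Y = "mat 1 1 (\<lambda>_. y)"
  have "mat_star ?Y * ?Y \<in> pos_mats 1 UNIV"
    by (auto simp: pos_mats_def mat_alg_iff)
  then have "map_mat \<phi> (mat_star ?Y * ?Y) \<in> pos_mats 1 T"
    using assms(1) by (simp add: completely_positive_def)
  then obtain Z where Z: "Z \<in> mat_alg 1 T" "map_mat \<phi> (mat_star ?Y * ?Y) = mat_star Z * Z"
    by (auto simp: pos_mats_def)
  have dim: "dim_row Z = 1" "dim_col Z = 1" using Z(1) by (auto simp: mat_alg_iff)
  have "\<phi> X = map_mat \<phi> (mat_star ?Y * ?Y) $$ (0, 0)"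
    by (simp add: mat_star_def scalar_prod_def y)
  also have "\<dots> = star (Z $$ (0, 0)) * Z $$ (0, 0)"
    unfolding Z(2) using dim by (simp add: mat_star_def scalar_prod_def)
  finally have "\<phi> X = star (Z $$ (0, 0)) * Z $$ (0, 0)" .
  moreover have "Z $$ (0, 0) \<in> T" using Z(1) by (simp add: mat_alg_iff)
  ultimately show ?thesis by (auto simp: pos_elems_def)
qed

text \<open>If \<open>Y = Z* Z\<close>, the compression is \<open>W* W\<close> where \<open>W\<close> is \<open>Z\<close> with every entry multiplied on the
  right by \<open>R\<close>.\<close>

lemma pos_mats_compression:
  assumes B: "cstar_subalgebra B" and R: "R \<in> B" and Y: "Y \<in> pos_mats n B"
  shows "map_mat (\<lambda>y. star R * y * R) Y \<in> pos_mats n B"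
proof -
  obtain Z where Z: "Z \<in> mat_alg n B" "Y = mat_star Z * Z" using Y by (auto simp: pos_mats_def)
  let ?W = "map_mat (\<lambda>z. z * R) Z"
  have dim: "dim_row Z = n" "dim_col Z = n" using Z(1) by (auto simp: mat_alg_iff)
  have "?W \<in> mat_alg n B"
    using Z(1) B R by (auto simp: mat_alg_iff cstar_subalgebra_def)
  moreover have "map_mat (\<lambda>y. star R * y * R) Y = mat_star ?W * ?W"
    by (rule eq_matI) (auto simp: Z(2) dim mat_star_def scalar_prod_def star_mult
        sum_distrib_left sum_distrib_right mult.assoc)
  ultimately show ?thesis by (auto simp: pos_mats_def)
qed

lemma completely_positive_compression:
  fixes \<phi> :: "'a::cstar_algebra \<Rightarrow> 'b::cstar_algebra"
  assumes B: "cstar_subalgebra B" and R: "R \<in> B" and \<phi>: "completely_positive B \<phi>"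
  shows "completely_positive B (\<lambda>X. star R * \<phi> X * R)"
  unfolding completely_positive_def
proof (intro conjI allI impI ballI)
  show "clinear (\<lambda>X. star R * \<phi> X * R)"
    using \<phi> by (simp add: completely_positive_def clinear_iff algebra_simps
        mult_scaleC_left mult_scaleC_right)
  show "range (\<lambda>X. star R * \<phi> X * R) \<subseteq> B"
    using \<phi> B R by (auto simp: completely_positive_def cstar_subalgebra_def)
  fix n :: nat and X :: "'a mat"
  assume "1 \<le> n" "X \<in> pos_mats n UNIV"
  then have "map_mat \<phi> X \<in> pos_mats n B" using \<phi> by (simp add: completely_positive_def)
  moreover have "map_mat (\<lambda>X. star R * \<phi> X * R) X
      = map_mat (\<lambda>y. star R * y * R) (map_mat \<phi> X)"
    by (rule eq_matI) auto
  ultimately show "map_mat (\<lambda>X. star R * \<phi> X * R) X \<in> pos_mats n B"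
    using pos_mats_compression[OF B R] by simp
qed

lemma norm_projection_le_1: "is_projection P \<Longrightarrow> norm P \<le> 1"
  using norm_star_mult_self[of P]
  by (cases "norm P = 0") (simp_all add: is_projection_def power2_eq_square)

lemma is_projection_complement:
  assumes "is_projection (R :: 'h::chilbert_space bop)"
  shows "is_projection (1 - R)"
proof -
  have "star (1 :: 'h bop) = 1" by (rule star_bop_eqI) (simp add: is_adjoint_def)
  moreover have "1 * T = T" "T * 1 = T" for T :: "'h bop" by (rule bop_eqI; simp)+
  ultimately show ?thesis using assms by (simp add: is_projection_def star_diff algebra_simps)
qed

text \<open>Let \<open>T = Y* Y\<close> and \<open>t > 0\<close>. The difference of the two sides is \<open>t (Y R)* (1 - b) (Y R)\<close> with
  \<open>b = t\<^sup>-\<^sup>1 Y P Y*\<close>, which has norm at most \<open>1\<close> because \<open>\<parallel>Y\<parallel>\<^sup>2 = \<parallel>T\<parallel> \<le> t\<close>. So \<open>1 - b = (1 - s)\<^sup>2\<close> with \<open>s\<close>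
  self-adjoint, and the difference is \<open>t V* V\<close> with \<open>V = (1 - s) Y R\<close>.\<close>

lemma corner_inequality:
  fixes T :: "'h::chilbert_space bop"
  assumes R: "is_projection R" and P: "is_projection P" and T: "T \<in> pos_elems UNIV"
    and t: "norm T \<le> t"
  shows "star (T * R) * P * (T * R) \<preceq> t *\<^sub>R (R * (T * R))"
proof (cases "t = 0")
  case True
  then show ?thesis using t by (auto simp: cstar_le_def pos_elems_def intro: exI[of _ 0])
next
  case False
  then have t0: "0 < t" using t norm_ge_zero[of T] by linarith
  obtain Y where Y: "T = star Y * Y" using T by (auto simp: pos_elems_def)
  have R': "star R = R" and P': "star P = P" "P * P = P"
    using R P by (auto simp: is_projection_def)
  define b where "b = inverse t *\<^sub>R (Y * P * star Y)"
  have "norm (Y * P * star Y) = (norm (P * star Y))\<^sup>2"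
    using norm_star_mult_self[of "P * star Y"]
    by (simp add: star_mult star_star P' mult.assoc) (simp add: P' mult.assoc[symmetric])
  also have "\<dots> \<le> (norm P * norm Y)\<^sup>2"
    using norm_mult_ineq[of P "star Y"] by (intro power_mono) simp_all
  also have "\<dots> \<le> (norm Y)\<^sup>2"
    using norm_projection_le_1[OF P] by (intro power_mono) (simp_all add: mult_left_le_one_le)
  also have "\<dots> = norm T" by (simp add: Y norm_star_mult_self)
  finally have "norm (Y * P * star Y) \<le> t" using t by simp
  then have "norm b \<le> 1" using t0 by (simp add: b_def field_simps)
  moreover have "star b = b" by (simp add: b_def star_scaleR star_mult star_star P' mult.assoc)
  ultimately obtain s where s: "star s = s" "s * s = 2 *\<^sub>R s - b" using sqrt_one_minus by metis
  define V where "V = Y * R - s * (Y * R)"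
  have "star V * V = star (Y * R) * (Y * R) - star (Y * R) * (2 *\<^sub>R s - s * s) * (Y * R)"
    by (simp add: V_def star_diff star_mult s(1) algebra_simps scaleR_2)
  also have "2 *\<^sub>R s - s * s = b" by (simp add: s(2))
  finally have "star V * V = star (Y * R) * (Y * R) - star (Y * R) * b * (Y * R)" .
  moreover have "sqrt t * (sqrt t * inverse t) = 1"
    using t0 by (simp add: mult.assoc[symmetric])
  ultimately have "t *\<^sub>R (R * (T * R)) - star (T * R) * P * (T * R)
      = star (sqrt t *\<^sub>R V) * (sqrt t *\<^sub>R V)"
    using t0 by (simp add: star_scaleR b_def Y star_mult star_star R' scaleR_diff_right mult.assoc)
  then show ?thesis unfolding cstar_le_def pos_elems_def by blast
qed

theorem theorem3p2:
  fixes B :: "'h::chilbert_space bop set"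
    and R :: "'h bop"
    and \<beta> :: "'a::cstar_algebra \<Rightarrow> 'h bop"
  assumes "cstar_subalgebra B"
    and "R \<in> B" and "is_projection R"
    and "clinear \<beta>" and "range \<beta> \<subseteq> mult_right B R"
    and "cp_completable B R \<beta>"
  shows "completely_positive B (\<lambda>X. R * \<beta> X)
    \<and> (\<exists>q\<ge>0. \<forall>X\<in>pos_elems UNIV.
          star (\<beta> X) * (1 - R) * \<beta> X \<preceq> (q * norm X) *\<^sub>R (R * \<beta> X))
    \<and> (\<forall>n\<ge>1. \<forall>X\<in>pos_mats n UNIV. positive_completable n B R (map_mat \<beta> X))"
proof -
  obtain \<phi> where \<phi>: "completely_positive B \<phi>" and \<beta>: "\<beta> = (\<lambda>X. \<phi> X * R)"
    using assms(6) by (auto simp: cp_completable_def)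
  have pos: "\<phi> X \<in> pos_elems UNIV" if "X \<in> pos_elems UNIV" for X
    using completely_positive_pos_elems[OF \<phi> that] by (auto simp: pos_elems_def)
  have "completely_positive B (\<lambda>X. R * \<beta> X)"
    using completely_positive_compression[OF assms(1,2) \<phi>] assms(3)
    by (simp add: \<beta> is_projection_def mult.assoc)
  moreover have "\<exists>q\<ge>0. \<forall>X\<in>pos_elems UNIV.
      star (\<beta> X) * (1 - R) * \<beta> X \<preceq> (q * norm X) *\<^sub>R (R * \<beta> X)"
  proof -
    have "clinear \<phi>" using \<phi> by (simp add: completely_positive_def)
    moreover have "\<phi> (star y * y) \<in> pos_elems UNIV" for y
      by (rule pos) (auto simp: pos_elems_def)
    ultimately obtain q where q: "0 \<le> q" "\<And>y. norm (\<phi> (star y * y)) \<le> q * norm (star y * y)"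
      using positive_map_bounded by blast
    have "star (\<beta> X) * (1 - R) * \<beta> X \<preceq> (q * norm X) *\<^sub>R (R * \<beta> X)"
      if X: "X \<in> pos_elems UNIV" for X
    proof -
      have "norm (\<phi> X) \<le> q * norm X" using X q(2) by (auto simp: pos_elems_def)
      then show ?thesis
        unfolding \<beta>
        by (intro corner_inequality is_projection_complement assms(3) pos X)
    qed
    then show ?thesis using q(1) by blast
  qed
  moreover have "positive_completable n B R (map_mat \<beta> X)"
    if n: "1 \<le> n" and X: "X \<in> pos_mats n UNIV" for n X
  proof -
    have "map_mat \<phi> X \<in> pos_mats n B" using \<phi> n X by (simp add: completely_positive_def)
    moreover have "map_mat (\<lambda>y. y * R) (map_mat \<phi> X) = map_mat \<beta> X"
      by (rule eq_matI) (auto simp: \<beta>)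
    moreover have "map_mat \<beta> X \<in> mat_alg n (mult_right B R)"
      using X assms(5) by (auto simp: mat_alg_iff pos_mats_def mat_star_def)
    ultimately show ?thesis by (auto simp: positive_completable_def)
  qed
  ultimately show ?thesis by blast
qed

end
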